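(* Let $(X,Y)$ be an ordered norming dual pair and let $\tau_+$ be the topology on $X$ of uniform convergence on the $\sigma'$-compact subsets of $Y^+$. If $\mathbf{T}$ is a positive, $\tau_+$-continuous semigroup of type $(M,\omega)$ on $(X,Y)$, then $\mathbf{T}$ is ${}_\alpha$quasi-$\tau_+$-equicontinuous for every $\alpha>\omega$.
   Context: A dual pair $(X,Y,\langle\cdot,\cdot\rangle)$ consists of vector spaces over $\mathbb{K}=\mathbb{R}$ or $\mathbb{C}$ and a bilinear form $X\times Y\to\mathbb{K}$ separating points. It is a norming dual pair if $X,Y$ are Banach spaces with $\|x\|=\sup\{|\langle x,y\rangle|:y\in Y,\|y\|\le1\}$ and $\|y\|=\sup\{|\langle x,y\rangle|:x\in X,\|x\|\le1\}$. $\sigma=\sigma(X,Y)$ and $\sigma'=\sigma(Y,X)$ are the weak topologies on $X$ and $Y$. For a locally convex topology $\tau$ on $X$, $L(X,\tau)$ is the algebra of $\tau$-continuous linear operators on $X$. An ordered norming dual pair is a norming dual pair $(X,Y)$ where $X$ is an ordered Banach space with $\sigma$-closed positive cone $X^+$. The dual cone is $Y^+=\{y\in Y:\langle x,y\rangle\ge0\ \forall x\in X^+\}$. An operator $T\in L(X,\sigma)$ is positive if $TX^+\subset X^+$; a semigroup is positive if every $T(t)$ is positive. The topology $\tau_+$ is generated by the seminorms $x\mapsto\sup_{y\in\mathcal{K}}|\langle x,y\rangle|$, $\mathcal{K}\subset Y^+$ $\sigma'$-compact. A semigroup on $(X,Y)$ is a family $\mathbf{T}=(T(t))_{t\ge0}\subset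 L(X,\sigma)$ with $T(0)=I$, $T(t+s)=T(t)T(s)$ for all $t,s\ge0$, which is exponentially bounded: $\|T(t)\|\le Me^{\omega t}$ for all $t\ge0$ and some $M\ge1$, $\omega\in\mathbb{R}$; then $\mathbf{T}$ is of type $(M,\omega)$. $\mathbf{T}$ is $\tau$-continuous if $t\mapsto T(t)x$ is $\tau$-continuous on $[0,\infty)$ for every $x\in X$. A set $\mathcal{S}\subset L(X,\tau)$ is $\tau$-equicontinuous if for every $\tau$-continuous seminorm $p$ there is a $\tau$-continuous seminorm $q$ with $p(Tx)\le q(x)$ for all $x\in X$, $T\in\mathcal{S}$. $\mathbf{T}$ is ${}_\alpha$quasi-$\tau$-equicontinuous if $\{e^{-\alpha t}T(t):t\ge0\}$ is $\tau$-equicontinuous. *)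

theory Defs
  imports "HOL-Analysis.Analysis"
begin

text \<open>
  The scalar field \<open>\<K> \<in> {\<real>, \<complex>}\<close> is rendered as a type of class \<open>real_normed_field\<close>: by the
  theorem of Gelfand and Mazur the fields of this class are, up to isometric isomorphism,
  exactly \<open>\<real>\<close> and \<open>\<complex>\<close>.  As the library has no complex vector spaces, the scalar
  multiplications are explicit parameters.
\<close>

locale dual_pair =
  X: vector_space scaleX + Y: vector_space scaleY
  for scaleX :: "'k::real_normed_field \<Rightarrow> 'x::ab_group_add \<Rightarrow> 'x"
    and scaleY :: "'k \<Rightarrow> 'y::ab_group_add \<Rightarrow> 'y" +
  fixes pairing :: "'x \<Rightarrow> 'y \<Rightarrow> 'k"
  assumes linear_left: "Vector_Spaces.linear scaleX (*) (\<lambda>x. pairing x y)"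
    and linear_right: "Vector_Spaces.linear scaleY (*) (\<lambda>y. pairing x y)"
    and separates_X: "(\<forall>y. pairing x y = 0) \<Longrightarrow> x = 0"
    and separates_Y: "(\<forall>x. pairing x y = 0) \<Longrightarrow> y = 0"

locale banach_space_over = vector_space scaleE
  for scaleE :: "'k::real_normed_field \<Rightarrow> 'x::banach \<Rightarrow> 'x" +
  assumes scale_of_real: "scaleE (of_real r) x = r *\<^sub>R x"
    and norm_scale: "norm (scaleE c x) = norm c * norm x"

text \<open>The \<open>bdd_above\<close> assumptions say that the suprema are finite; a supremum of an unbounded
  set of type \<^typ>\<open>real\<close> is meaningless.\<close>

locale norming_dual_pair =
  dual_pair scaleX scaleY pairing + X: banach_space_over scaleX + Y: banach_space_over scaleY
  for scaleX :: "'k::real_normed_field \<Rightarrow> 'x::banach \<Rightarrow> 'x"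
    and scaleY :: "'k \<Rightarrow> 'y::banach \<Rightarrow> 'y"
    and pairing :: "'x \<Rightarrow> 'y \<Rightarrow> 'k" +
  assumes bdd_X: "bdd_above ((\<lambda>y. norm (pairing x y)) ` {y. norm y \<le> 1})"
    and norming_X: "norm x = (SUP y\<in>{y. norm y \<le> 1}. norm (pairing x y))"
    and bdd_Y: "bdd_above ((\<lambda>x. norm (pairing x y)) ` {x. norm x \<le> 1})"
    and norming_Y: "norm y = (SUP x\<in>{x. norm x \<le> 1}. norm (pairing x y))"

definition weak_topology :: "('x \<Rightarrow> 'y \<Rightarrow> 'k::topological_space) \<Rightarrow> 'x topology" where
  "weak_topology pairing = topology_generated_by {(\<lambda>x. pairing x y) -` U | y U. open U}"

abbreviation sigma_X :: "('x \<Rightarrow> 'y \<Rightarrow> 'k::topological_space) \<Rightarrow> 'x topology" where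
  "sigma_X pairing \<equiv> weak_topology pairing"

abbreviation sigma_Y :: "('x \<Rightarrow> 'y \<Rightarrow> 'k::topological_space) \<Rightarrow> 'y topology" where
  "sigma_Y pairing \<equiv> weak_topology (\<lambda>y x. pairing x y)"

text \<open>The order of \<open>X\<close> is that of the class \<open>ordered_real_vector\<close>, so that \<open>X\<^sup>+ = {x. 0 \<le> x}\<close> is a
  proper convex cone; for \<open>\<K> = \<complex>\<close> this is a cone in the underlying real space.\<close>

locale ordered_norming_dual_pair = norming_dual_pair scaleX scaleY pairing
  for scaleX :: "'k::real_normed_field \<Rightarrow> 'x::{banach, ordered_real_vector} \<Rightarrow> 'x"
    and scaleY :: "'k \<Rightarrow> 'y::banach \<Rightarrow> 'y"
    and pairing :: "'x \<Rightarrow> 'y \<Rightarrow> 'k" +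
  assumes closed_cone: "closedin (sigma_X pairing) {x. 0 \<le> x}"

text \<open>In \<open>\<K>\<close>, \<open>a \<ge> 0\<close> means that \<open>a\<close> is a nonnegative real number.\<close>

definition dual_cone :: "('x::{zero, ord} \<Rightarrow> 'y \<Rightarrow> 'k::real_normed_field) \<Rightarrow> 'y set" where
  "dual_cone pairing = {y. \<forall>x\<ge>0. pairing x y \<in> \<real>\<^sub>\<ge>\<^sub>0}"

definition seminorm_topology :: "('x::ab_group_add \<Rightarrow> real) set \<Rightarrow> 'x topology" where
  "seminorm_topology P =
     topology_generated_by (insert UNIV {{x. p (x - a) < e} | p a e. p \<in> P \<and> 0 < e})"

text \<open>The empty set \<open>K\<close> is left out because \<open>Sup {}\<close> is unspecified in \<^typ>\<open>real\<close>; mathematically it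
  contributes only the zero seminorm, which is also the contribution of \<open>K = {0}\<close>.\<close>

definition tau_plus ::
    "('x::{ab_group_add, ord} \<Rightarrow> 'y \<Rightarrow> 'k::real_normed_field) \<Rightarrow> 'x topology" where
  "tau_plus pairing = seminorm_topology
     {(\<lambda>x. SUP y\<in>K. norm (pairing x y)) | K.
        K \<noteq> {} \<and> K \<subseteq> dual_cone pairing \<and> compactin (sigma_Y pairing) K}"

definition continuous_operators ::
    "('k::field \<Rightarrow> 'x::ab_group_add \<Rightarrow> 'x) \<Rightarrow> 'x topology \<Rightarrow> ('x \<Rightarrow> 'x) set" where
  "continuous_operators scaleE \<tau> =
     {S. Vector_Spaces.linear scaleE scaleE S \<and> continuous_map \<tau> \<tau> S}"

text \<open>A family \<open>T :: real \<Rightarrow> _\<close> is only looked at for \<open>t \<ge> 0\<close>.  That \<open>T t\<close> is norm bounded is part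
  of the meaning of \<open>\<parallel>T(t)\<parallel> \<le> M e\<^sup>\<omega>\<^sup>t\<close>: on unbounded operators \<open>onorm\<close> is meaningless.\<close>

definition semigroup_of_type ::
    "('k::real_normed_field \<Rightarrow> 'x::banach \<Rightarrow> 'x) \<Rightarrow> ('x \<Rightarrow> 'y \<Rightarrow> 'k) \<Rightarrow>
     real \<Rightarrow> real \<Rightarrow> (real \<Rightarrow> 'x \<Rightarrow> 'x) \<Rightarrow> bool" where
  "semigroup_of_type scaleX pairing M \<omega> T \<longleftrightarrow>
     (\<forall>t\<ge>0. T t \<in> continuous_operators scaleX (sigma_X pairing)) \<and>
     T 0 = id \<and> (\<forall>t\<ge>0. \<forall>s\<ge>0. T (t + s) = T t \<circ> T s) \<and>
     1 \<le> M \<and> (\<forall>t\<ge>0. bounded_linear (T t) \<and> onorm (T t) \<le> M * exp (\<omega> * t))"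

definition positive_operator :: "('x::{zero, ord} \<Rightarrow> 'x) \<Rightarrow> bool" where
  "positive_operator S \<longleftrightarrow> S ` {x. 0 \<le> x} \<subseteq> {x. 0 \<le> x}"

definition positive_semigroup :: "(real \<Rightarrow> 'x::{zero, ord} \<Rightarrow> 'x) \<Rightarrow> bool" where
  "positive_semigroup T \<longleftrightarrow> (\<forall>t\<ge>0. positive_operator (T t))"

definition continuous_semigroup :: "'x topology \<Rightarrow> (real \<Rightarrow> 'x \<Rightarrow> 'x) \<Rightarrow> bool" where
  "continuous_semigroup \<tau> T \<longleftrightarrow> (\<forall>x. continuous_map (top_of_set {0..}) \<tau> (\<lambda>t. T t x))"

definition seminorm ::
    "('k::real_normed_field \<Rightarrow> 'x::ab_group_add \<Rightarrow> 'x) \<Rightarrow> ('x \<Rightarrow> real) \<Rightarrow> bool" where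
  "seminorm scaleE p \<longleftrightarrow>
     (\<forall>x. 0 \<le> p x) \<and> (\<forall>x y. p (x + y) \<le> p x + p y) \<and> (\<forall>c x. p (scaleE c x) = norm c * p x)"

definition continuous_seminorms ::
    "('k::real_normed_field \<Rightarrow> 'x::ab_group_add \<Rightarrow> 'x) \<Rightarrow> 'x topology \<Rightarrow> ('x \<Rightarrow> real) set" where
  "continuous_seminorms scaleE \<tau> = {p. seminorm scaleE p \<and> continuous_map \<tau> euclideanreal p}"

definition equicontinuous ::
    "('k::real_normed_field \<Rightarrow> 'x::ab_group_add \<Rightarrow> 'x) \<Rightarrow> 'x topology \<Rightarrow> ('x \<Rightarrow> 'x) set \<Rightarrow> bool"
  where
  "equicontinuous scaleE \<tau> \<S> \<longleftrightarrow>
     \<S> \<subseteq> continuous_operators scaleE \<tau> \<and>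
     (\<forall>p \<in> continuous_seminorms scaleE \<tau>. \<exists>q \<in> continuous_seminorms scaleE \<tau>.
        \<forall>S\<in>\<S>. \<forall>x. p (S x) \<le> q x)"

definition quasi_equicontinuous ::
    "('k::real_normed_field \<Rightarrow> 'x::ab_group_add \<Rightarrow> 'x) \<Rightarrow> 'x topology \<Rightarrow> real \<Rightarrow>
     (real \<Rightarrow> 'x \<Rightarrow> 'x) \<Rightarrow> bool" where
  "quasi_equicontinuous scaleE \<tau> \<alpha> T \<longleftrightarrow>
     equicontinuous scaleE \<tau> {(\<lambda>x. scaleE (of_real (exp (- \<alpha> * t))) (T t x)) | t. 0 \<le> t}"

end

theory Submission
  imports Defs
begin

text \<open>
  Let \<open>K \<subseteq> Y\<^sup>+\<close> be \<open>\<sigma>'\<close>-compact.  Since \<open>T\<close> is \<open>\<tau>\<^sub>+\<close>-continuous, \<open>\<langle>T(t)x, y\<rangle>\<close> depends continuously on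
  \<open>t\<close>, uniformly in \<open>y \<in> K\<close>, so \<open>(t, y) \<mapsto> e\<^sup>-\<^sup>\<alpha>\<^sup>tT(t)'y\<close> is jointly \<open>\<sigma>'\<close>-continuous on \<open>[0,\<infinity>) \<times> K\<close>.
  As \<open>K\<close> is norm bounded and \<open>\<alpha> > \<omega>\<close>, it extends continuously to \<open>[0,\<infinity>] \<times> K\<close> by \<open>0\<close> at infinity.
  Its image \<open>L\<close> is therefore \<open>\<sigma>'\<close>-compact, it lies in \<open>Y\<^sup>+\<close> by positivity, and
  \<open>p\<^sub>K(e\<^sup>-\<^sup>\<alpha>\<^sup>tT(t)x) \<le> p\<^sub>L(x)\<close> for all \<open>t \<ge> 0\<close>.
\<close>

section \<open>The uniform boundedness principle\<close>

text \<open>Baire's theorem: the closed sets \<open>E n\<close> of points where the family is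
  bounded by \<open>n\<close> cover the space, so one of them contains a ball. Linearity moves the
  bound from that ball to the origin. Below it turns pointwise boundedness on a weakly compact set
  into a norm bound.\<close>

lemma uniform_boundedness:
  fixes f :: "'i \<Rightarrow> 'x::banach \<Rightarrow> 'b::real_normed_vector"
  assumes lin: "\<And>i. i \<in> I \<Longrightarrow> bounded_linear (f i)"
    and ptw: "\<And>x. \<exists>B. \<forall>i\<in>I. norm (f i x) \<le> B"
  obtains C where "0 \<le> C" "\<And>i x. i \<in> I \<Longrightarrow> norm (f i x) \<le> C * norm x"
proof -
  define E where "E n = {x. \<forall>i\<in>I. norm (f i x) \<le> real n}" for n
  have closed_E: "closed (E n)" for n
  proof -
    have "E n = (\<Inter>i\<in>I. {x. norm (f i x) \<le> real n})"
      by (auto simp: E_def)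
    moreover have "closed {x. norm (f i x) \<le> real n}" if "i \<in> I" for i
      using linear_continuous_on[OF lin[OF that]]
      by (intro closed_Collect_le continuous_intros) auto
    ultimately show ?thesis by (auto intro: closed_INT)
  qed
  have cover: "UNIV = (\<Union>n. E n)"
  proof (rule UNIV_eq_I)
    fix x
    obtain B where B: "\<forall>i\<in>I. norm (f i x) \<le> B" using ptw by blast
    obtain n where "B \<le> real n" using real_arch_simple by blast
    then have "x \<in> E n" using B by (force simp: E_def)
    then show "x \<in> (\<Union>n. E n)" by blast
  qed
  have "\<exists>n. interior (E n) \<noteq> {}"
  proof (rule ccontr)
    assume *: "\<not> ?thesis"
    have "Met_TC.mtopology interior_of \<Union>(range E) = {}"
    proof (rule Met_TC.metric_Baire_category_alt)
      show "Met_TC.mcomplete TYPE('x)" by (simp add: complete_UNIV)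
      show "closedin Met_TC.mtopology T \<and> Met_TC.mtopology interior_of T = {}"
        if "T \<in> range E" for T
        using that closed_E * by auto
    qed simp
    then show False by (simp flip: cover)
  qed
  then obtain n x0 where "x0 \<in> interior (E n)" by blast
  then obtain e where e: "e > 0" "cball x0 e \<subseteq> E n"
    by (meson mem_interior_cball)
  show thesis
  proof (rule that)
    show "0 \<le> 2 * real n / e" using e by simp
    fix i x assume i: "i \<in> I"
    interpret bounded_linear "f i" by (rule lin[OF i])
    show "norm (f i x) \<le> 2 * real n / e * norm x"
    proof (cases "x = 0")
      case True then show ?thesis by (simp add: zero)
    next
      case False
      \<comment> \<open>Rescaling \<open>x\<close> to length \<open>e\<close> keeps
        \<open>x0 + u\<close> in the ball. Since \<open>f i u\<close> is the difference of the
        values at \<open>x0 + u\<close> and \<open>x0\<close>, each at most \<open>n\<close> in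
        norm, the constant \<open>2 * n / e\<close> results.\<close>
      define u where "u = (e / norm x) *\<^sub>R x"
      have "norm u = e" using False e by (simp add: u_def)
      then have "x0 + u \<in> E n" "x0 \<in> E n" using e by (auto simp: dist_norm)
      then have *: "norm (f i (x0 + u)) \<le> real n" "norm (f i x0) \<le> real n"
        using i by (auto simp: E_def)
      have "norm (f i u) \<le> 2 * real n"
        using * norm_triangle_ineq4[of "f i (x0 + u)" "f i x0"] by (simp add: add)
      moreover have "norm (f i u) = e / norm x * norm (f i x)"
        using e by (simp add: u_def scaleR)
      ultimately show ?thesis using e False by (simp add: field_simps)
    qed
  qed
qed

section \<open>Basic neighbourhoods in generated topologies\<close>

text \<open>Induction over the generation of an open set. Here \<open>N\<close> stands for being a
  neighbourhood of \<open>a\<close>: closure under supersets settles unions, closure under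
  intersections the finite meets, so only the generators through \<open>a\<close> need
  checking.\<close>

lemma generate_topology_on_neighbourhood:
  assumes "generate_topology_on \<S> U" "a \<in> U"
    and "\<And>S. S \<in> \<S> \<Longrightarrow> a \<in> S \<Longrightarrow> N S"
    and "\<And>V W. N V \<Longrightarrow> N W \<Longrightarrow> N (V \<inter> W)"
    and mono: "\<And>V W. N V \<Longrightarrow> V \<subseteq> W \<Longrightarrow> N W"
  shows "N U"
  using assms(1,2)
proof induction
  case (UN K)
  then obtain V where "V \<in> K" "a \<in> V" by blast
  then show ?case using UN.IH mono[of V "\<Union>K"] by blast
qed (use assms in auto)

text \<open>The generating balls have arbitrary centres; the triangle inequality replaces a ball
  around \<open>b\<close> by a smaller one around \<open>a\<close>. The generator
  \<open>UNIV\<close> corresponds to the empty family \<open>F\<close>.\<close>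

lemma seminorm_topology_contains_basic:
  assumes "openin (seminorm_topology P) U" "a \<in> U"
    and tri: "\<And>p x y. p \<in> P \<Longrightarrow> p (x + y) \<le> p x + p y"
  shows "\<exists>F e. finite F \<and> F \<subseteq> P \<and> 0 < e \<and> {x. \<forall>p\<in>F. p (x - a) < e} \<subseteq> U"
proof (rule generate_topology_on_neighbourhood)
  show "generate_topology_on (insert UNIV {{x. p (x - a) < e} | p a e. p \<in> P \<and> 0 < e}) U"
    using assms(1) by (simp add: seminorm_topology_def openin_topology_generated_by_iff)
next
  fix V W
  assume "\<exists>F e. finite F \<and> F \<subseteq> P \<and> 0 < e \<and> {x. \<forall>p\<in>F. p (x - a) < e} \<subseteq> V"
  then obtain F e where F: "finite F" "F \<subseteq> P" "0 < e" "{x. \<forall>p\<in>F. p (x - a) < e} \<subseteq> V"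
    by auto
  assume "\<exists>F e. finite F \<and> F \<subseteq> P \<and> 0 < e \<and> {x. \<forall>p\<in>F. p (x - a) < e} \<subseteq> W"
  then obtain G d where G: "finite G" "G \<subseteq> P" "0 < d" "{x. \<forall>p\<in>G. p (x - a) < d} \<subseteq> W"
    by auto
  have "{x. \<forall>p\<in>F \<union> G. p (x - a) < min e d} \<subseteq> V \<inter> W"
    using F(4) G(4) by auto
  then show "\<exists>F e. finite F \<and> F \<subseteq> P \<and> 0 < e \<and> {x. \<forall>p\<in>F. p (x - a) < e} \<subseteq> V \<inter> W"
    using F(1-3) G(1-3) by (intro exI[of _ "F \<union> G"] exI[of _ "min e d"]) simp
next
  fix V W
  assume "\<exists>F e. finite F \<and> F \<subseteq> P \<and> 0 < e \<and> {x. \<forall>p\<in>F. p (x - a) < e} \<subseteq> V" "V \<subseteq> W"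
  then show "\<exists>F e. finite F \<and> F \<subseteq> P \<and> 0 < e \<and> {x. \<forall>p\<in>F. p (x - a) < e} \<subseteq> W"
    by (elim ex_forward conj_forward) (assumption | erule (1) subset_trans)+
next
  fix S assume a: "a \<in> S" and "S \<in> insert UNIV {{x. p (x - a) < e} | p a e. p \<in> P \<and> 0 < e}"
  then consider "S = UNIV" | p b r where "p \<in> P" "0 < r" "S = {x. p (x - b) < r}" by auto
  then show "\<exists>F e. finite F \<and> F \<subseteq> P \<and> 0 < e \<and> {x. \<forall>p\<in>F. p (x - a) < e} \<subseteq> S"
  proof cases
    case 1 then show ?thesis by (intro exI[of _ "{}"] exI[of _ 1]) simp
  next
    case 2
    \<comment> \<open>The new radius is what remains of \<open>r\<close> after the distance from
      \<open>a\<close> to \<open>b\<close>; it is positive because \<open>a\<close> lies in the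
      ball.\<close>
    have "x \<in> S" if "p (x - a) < r - p (a - b)" for x
      using tri[OF 2(1), of "x - a" "a - b"] that 2(3) by simp
    then show ?thesis
      using a 2 by (intro exI[of _ "{p}"] exI[of _ "r - p (a - b)"]) auto
  qed
qed (rule assms(2))

lemma weak_topology_contains_basic:
  fixes pairing :: "'x \<Rightarrow> 'y \<Rightarrow> 'k::metric_space"
  assumes "openin (weak_topology pairing) U" "a \<in> U"
  shows "\<exists>F e. finite F \<and> 0 < e \<and> {x. \<forall>y\<in>F. dist (pairing x y) (pairing a y) < e} \<subseteq> U"
proof (rule generate_topology_on_neighbourhood)
  show "generate_topology_on {(\<lambda>x. pairing x y) -` U | y U. open U} U"
    using assms(1) by (simp add: weak_topology_def openin_topology_generated_by_iff)
next
  fix V W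
  assume "\<exists>F e. finite F \<and> 0 < e \<and> {x. \<forall>y\<in>F. dist (pairing x y) (pairing a y) < e} \<subseteq> V"
  then obtain F e where F: "finite F" "0 < e" "{x. \<forall>y\<in>F. dist (pairing x y) (pairing a y) < e} \<subseteq> V"
    by auto
  assume "\<exists>F e. finite F \<and> 0 < e \<and> {x. \<forall>y\<in>F. dist (pairing x y) (pairing a y) < e} \<subseteq> W"
  then obtain G d where G: "finite G" "0 < d" "{x. \<forall>y\<in>G. dist (pairing x y) (pairing a y) < d} \<subseteq> W"
    by auto
  have "{x. \<forall>y\<in>F \<union> G. dist (pairing x y) (pairing a y) < min e d} \<subseteq> V \<inter> W"
    using F(3) G(3) by auto
  then show "\<exists>F e. finite F \<and> 0 < e \<and> {x. \<forall>y\<in>F. dist (pairing x y) (pairing a y) < e} \<subseteq> V \<inter> W"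
    using F(1,2) G(1,2) by (intro exI[of _ "F \<union> G"] exI[of _ "min e d"]) simp
next
  fix V W
  assume "\<exists>F e. finite F \<and> 0 < e \<and> {x. \<forall>y\<in>F. dist (pairing x y) (pairing a y) < e} \<subseteq> V" "V \<subseteq> W"
  then show "\<exists>F e. finite F \<and> 0 < e \<and> {x. \<forall>y\<in>F. dist (pairing x y) (pairing a y) < e} \<subseteq> W"
    by (elim ex_forward conj_forward) (assumption | erule (1) subset_trans)+
next
  fix S assume a: "a \<in> S" and "S \<in> {(\<lambda>x. pairing x y) -` U | y U. open U}"
  then obtain y V where S: "S = (\<lambda>x. pairing x y) -` V" "open V" by auto
  then obtain e where "0 < e" "\<forall>z. dist z (pairing a y) < e \<longrightarrow> z \<in> V"
    using a unfolding open_dist by auto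
  then show "\<exists>F e. finite F \<and> 0 < e \<and> {x. \<forall>y\<in>F. dist (pairing x y) (pairing a y) < e} \<subseteq> S"
    using S by (intro exI[of _ "{y}"] exI[of _ e]) auto
qed (rule assms(2))

lemma topspace_weak_topology [simp]: "topspace (weak_topology pairing) = UNIV"
proof -
  have "UNIV = (\<lambda>x. pairing x undefined) -` UNIV" by simp
  then show ?thesis unfolding weak_topology_def topology_generated_by_topspace
    by blast
qed

lemma topspace_seminorm_topology [simp]: "topspace (seminorm_topology P) = UNIV"
  by (simp add: seminorm_topology_def)

lemma continuous_map_pairing:
  "continuous_map (weak_topology pairing) euclidean (\<lambda>x. pairing x y)"
  unfolding continuous_map_alt
proof (intro conjI allI impI)
  fix U :: "'b set" assume "openin euclidean U"
  then show "openin (weak_topology pairing) ((\<lambda>x. pairing x y) -` U \<inter> topspace (weak_topology pairing))"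
    unfolding topspace_weak_topology by (auto simp: weak_topology_def intro!: topology_generated_by_Basis)
qed auto

lemma openin_seminorm_ball:
  assumes "p \<in> P" "0 < e" shows "openin (seminorm_topology P) {x. p (x - a) < e}"
  unfolding seminorm_topology_def using assms by (intro topology_generated_by_Basis) blast


section \<open>Weakly continuous functionals and adjoints\<close>

text \<open>Linear algebra only: a functional vanishing on the common kernel of finitely many
  functionals is a linear combination of them. The induction removes one functional at a
  time.\<close>

lemma (in dual_pair) exists_pairing_of_ker_subset:
  assumes "finite F" "Vector_Spaces.linear scaleX (*) f"
    and "\<And>x. (\<And>y. y \<in> F \<Longrightarrow> pairing x y = 0) \<Longrightarrow> f x = 0"
  shows "\<exists>y. \<forall>x. f x = pairing x y"
  using assms
proof (induction F arbitrary: f rule: finite_induct)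
  case empty
  interpret R: Vector_Spaces.linear scaleY "(*)" "\<lambda>y. pairing x y" for x by (rule linear_right)
  show ?case using empty by (intro exI[of _ 0]) (simp add: R.zero)
next
  case (insert y F)
  interpret f: Vector_Spaces.linear scaleX "(*)" f by (rule insert.prems)
  interpret L: Vector_Spaces.linear scaleX "(*)" "\<lambda>x. pairing x z" for z by (rule linear_left)
  interpret R: Vector_Spaces.linear scaleY "(*)" "\<lambda>y. pairing x y" for x by (rule linear_right)
  show ?case
  proof (cases "\<forall>x. (\<forall>z\<in>F. pairing x z = 0) \<longrightarrow> pairing x y = 0")
    case True
    have *: "f x = 0" if "\<And>z. z \<in> F \<Longrightarrow> pairing x z = 0" for x
      by (rule insert.prems) (use that True in auto)
    show ?thesis by (rule insert.IH[OF insert.prems(1) *])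
  next
    case False
    then obtain x0 where x0: "\<And>z. z \<in> F \<Longrightarrow> pairing x0 z = 0" "pairing x0 y \<noteq> 0" by auto
    \<comment> \<open>With this coefficient \<open>f - c * pairing _ y\<close> vanishes at
      \<open>x0\<close>, and hence on the whole common kernel of \<open>F\<close>.\<close>
    define c where "c = f x0 / pairing x0 y"
    have "\<exists>y'. \<forall>x. f x - c * pairing x y = pairing x y'"
    proof (rule insert.IH)
      show "Vector_Spaces.linear scaleX (*) (\<lambda>x. f x - c * pairing x y)"
        using f.linear_axioms L.linear_axioms[of y]
        unfolding Vector_Spaces.linear_iff by (simp add: algebra_simps)
      fix x assume x: "\<And>z. z \<in> F \<Longrightarrow> pairing x z = 0"
      \<comment> \<open>Projecting along \<open>x0\<close> puts \<open>x\<close> into the kernel of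
        \<open>y\<close> without leaving the kernels indexed by \<open>F\<close>, so
        \<open>f\<close> vanishes at the projection.\<close>
      let ?u = "x - scaleX (pairing x y / pairing x0 y) x0"
      have "f ?u = 0"
        by (rule insert.prems) (use x x0 in \<open>auto simp: L.diff L.scale\<close>)
      then show "f x - c * pairing x y = 0"
        by (simp add: f.diff f.scale c_def mult.commute)
    qed
    then obtain y' where "\<forall>x. f x - c * pairing x y = pairing x y'" by blast
    then have "\<forall>x. f x = pairing x (y' + scaleY c y)"
      by (metis R.add R.scale diff_add_cancel)
    then show ?thesis by blast
  qed
qed

text \<open>A weak zero neighbourhood on which \<open>f\<close> stays below 1 contains the common
  kernel of finitely many elements of \<open>Y\<close>. That kernel is a subspace, so scaling forces
  \<open>f\<close> to vanish on it.\<close>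

lemma (in dual_pair) weakly_continuous_functional:
  assumes lin: "Vector_Spaces.linear scaleX (*) f"
    and cont: "continuous_map (sigma_X pairing) euclidean f"
  shows "\<exists>y. \<forall>x. f x = pairing x y"
proof -
  interpret f: Vector_Spaces.linear scaleX "(*)" f by (rule lin)
  interpret L: Vector_Spaces.linear scaleX "(*)" "\<lambda>x. pairing x z" for z by (rule linear_left)
  have "openin (sigma_X pairing) {x \<in> topspace (sigma_X pairing). f x \<in> ball 0 1}"
    by (rule openin_continuous_map_preimage[OF cont]) simp
  then have "openin (sigma_X pairing) {x. norm (f x) < 1}" by simp
  from weak_topology_contains_basic[OF this, of 0]
  obtain F e where F: "finite F" "0 < e"
    "{x. \<forall>y\<in>F. dist (pairing x y) (pairing 0 y) < e} \<subseteq> {x. norm (f x) < 1}"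
    by (auto simp: f.zero)
  show ?thesis
  proof (rule exists_pairing_of_ker_subset[OF F(1) lin], rule ccontr)
    fix x assume x: "\<And>y. y \<in> F \<Longrightarrow> pairing x y = 0" and "f x \<noteq> 0"
    have "scaleX (1 / f x) x \<in> {x. \<forall>y\<in>F. dist (pairing x y) (pairing 0 y) < e}"
      using x F(2) by (simp add: L.scale L.zero)
    then have "norm (f (scaleX (1 / f x) x)) < 1" using F(3) by blast
    then show False using \<open>f x \<noteq> 0\<close> by (simp add: f.scale)
  qed
qed

text \<open>Provides the vector \<open>S'y\<close> inside \<open>Y\<close> itself: composing
  \<open>S\<close> with the functional of \<open>y\<close> is again weakly continuous.\<close>

lemma (in dual_pair) adjoint_exists:
  assumes "S \<in> continuous_operators scaleX (sigma_X pairing)"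
  shows "\<exists>y'. \<forall>x. pairing (S x) y = pairing x y'"
proof (rule weakly_continuous_functional)
  have S: "Vector_Spaces.linear scaleX scaleX S" "continuous_map (sigma_X pairing) (sigma_X pairing) S"
    using assms by (auto simp: continuous_operators_def)
  show "Vector_Spaces.linear scaleX (*) (\<lambda>x. pairing (S x) y)"
    using S(1) linear_left[of y] unfolding Vector_Spaces.linear_iff by simp
  show "continuous_map (sigma_X pairing) euclidean (\<lambda>x. pairing (S x) y)"
    using continuous_map_compose[OF S(2) continuous_map_pairing[of pairing y]] by (simp add: o_def)
qed

section \<open>The seminorms that generate tau_+\<close>

text \<open>This is the seminorm \<open>p\<^sub>K\<close>. The real supremum behaves as intended for
  nonempty weakly compact \<open>K\<close>, where the values are bounded.\<close>

definition sup_seminorm :: "('x \<Rightarrow> 'y \<Rightarrow> 'k::real_normed_field) \<Rightarrow> 'y set \<Rightarrow> 'x \<Rightarrow> real" where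
  "sup_seminorm pairing K x = (SUP y\<in>K. norm (pairing x y))"

definition cone_compact :: "('x::{zero, ord} \<Rightarrow> 'y \<Rightarrow> 'k::real_normed_field) \<Rightarrow> 'y set \<Rightarrow> bool" where
  "cone_compact pairing K \<longleftrightarrow>
     K \<noteq> {} \<and> K \<subseteq> dual_cone pairing \<and> compactin (sigma_Y pairing) K"

lemma tau_plus_eq:
  "tau_plus pairing = seminorm_topology (sup_seminorm pairing ` {K. cone_compact pairing K})"
proof -
  have "{(\<lambda>x. SUP y\<in>K. norm (pairing x y)) | K.
        K \<noteq> {} \<and> K \<subseteq> dual_cone pairing \<and> compactin (sigma_Y pairing) K}
      = sup_seminorm pairing ` {K. cone_compact pairing K}"
    unfolding cone_compact_def sup_seminorm_def[abs_def] by blast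
  then show ?thesis unfolding tau_plus_def by simp
qed

lemma topspace_tau_plus [simp]: "topspace (tau_plus pairing) = UNIV"
  by (simp add: tau_plus_eq)

section \<open>The pairing as a bounded form, and suprema over weakly compact sets\<close>

context norming_dual_pair
begin

lemma pairing_scaleR_left: "pairing (r *\<^sub>R x) y = r *\<^sub>R pairing x y"
proof -
  interpret L: Vector_Spaces.linear scaleX "(*)" "\<lambda>x. pairing x z" for z by (rule linear_left)
  show ?thesis by (metis L.scale X.scale_of_real scaleR_conv_of_real)
qed

lemma pairing_scaleR_right: "pairing x (r *\<^sub>R y) = r *\<^sub>R pairing x y"
proof -
  interpret R: Vector_Spaces.linear scaleY "(*)" "\<lambda>y. pairing x y" for x by (rule linear_right)
  show ?thesis by (metis R.scale Y.scale_of_real scaleR_conv_of_real)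
qed

lemma pairing_add_left: "pairing (x + x') y = pairing x y + pairing x' y"
  using linear_left[of y] by (simp add: Vector_Spaces.linear_iff)

lemma pairing_scale_left: "pairing (scaleX c x) y = c * pairing x y"
  using linear_left[of y] by (simp add: Vector_Spaces.linear_iff)

lemma pairing_zero_left [simp]: "pairing 0 y = 0"
  using pairing_scaleR_left[of 0 0 y] by simp

lemma pairing_zero_right [simp]: "pairing x 0 = 0"
  using pairing_scaleR_right[of x 0 0] by simp

lemma pairing_diff_left: "pairing (x - x') y = pairing x y - pairing x' y"
  using pairing_add_left[of "x - x'" x' y] by simp

text \<open>After \<open>y\<close> is normalised, the norming supremum for \<open>x\<close>
  applies.\<close>

lemma norm_pairing_le: "norm (pairing x y) \<le> norm x * norm y"
proof (cases "y = 0")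
  case False
  define u where "u = (1 / norm y) *\<^sub>R y"
  have "norm (pairing x u) \<le> norm x"
    unfolding norming_X[of x] by (rule cSUP_upper[OF _ bdd_X]) (use False in \<open>simp add: u_def\<close>)
  then show ?thesis using False by (simp add: u_def pairing_scaleR_right field_simps)
qed simp

lemma bounded_linear_pairing: "bounded_linear (\<lambda>x. pairing x y)"
  by (rule bounded_linear_intro[of _ "norm y"])
    (auto simp: pairing_add_left pairing_scaleR_left norm_pairing_le)

context
  fixes K assumes K: "compactin (sigma_Y pairing) K" "K \<noteq> {}"
begin

lemma bdd_above_pairing: "bdd_above ((\<lambda>y. norm (pairing x y)) ` K)"
proof -
  have "compactin euclidean ((\<lambda>y. pairing x y) ` K)"
    using image_compactin[OF K(1) continuous_map_pairing[of "\<lambda>y x. pairing x y" x]] .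
  then have "bounded ((\<lambda>y. pairing x y) ` K)" by (simp add: compact_imp_bounded)
  then show ?thesis by (auto simp: bounded_iff bdd_above_def)
qed

lemma norm_pairing_le_sup_seminorm: "y \<in> K \<Longrightarrow> norm (pairing x y) \<le> sup_seminorm pairing K x"
  unfolding sup_seminorm_def by (rule cSUP_upper[OF _ bdd_above_pairing])

lemma sup_seminorm_le: "(\<And>y. y \<in> K \<Longrightarrow> norm (pairing x y) \<le> c) \<Longrightarrow> sup_seminorm pairing K x \<le> c"
  unfolding sup_seminorm_def by (rule cSUP_least[OF K(2)])

lemma sup_seminorm_nonneg: "0 \<le> sup_seminorm pairing K x"
  using K(2) norm_pairing_le_sup_seminorm order_trans[OF norm_ge_zero] by blast

lemma sup_seminorm_add: "sup_seminorm pairing K (x + x') \<le> sup_seminorm pairing K x + sup_seminorm pairing K x'"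
proof (rule sup_seminorm_le)
  fix y assume "y \<in> K"
  then show "norm (pairing (x + x') y) \<le> sup_seminorm pairing K x + sup_seminorm pairing K x'"
    unfolding pairing_add_left
    by (intro order_trans[OF norm_triangle_ineq] add_mono norm_pairing_le_sup_seminorm)
qed

lemma sup_seminorm_scale: "sup_seminorm pairing K (scaleX c x) = norm c * sup_seminorm pairing K x"
proof (rule antisym)
  show "sup_seminorm pairing K (scaleX c x) \<le> norm c * sup_seminorm pairing K x"
    by (rule sup_seminorm_le)
      (simp add: pairing_scale_left norm_mult mult_left_mono norm_pairing_le_sup_seminorm)
  show "norm c * sup_seminorm pairing K x \<le> sup_seminorm pairing K (scaleX c x)"
  proof (cases "c = 0")
    case False
    have "sup_seminorm pairing K x \<le> sup_seminorm pairing K (scaleX c x) / norm c"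
    proof (rule sup_seminorm_le)
      fix y assume "y \<in> K"
      then show "norm (pairing x y) \<le> sup_seminorm pairing K (scaleX c x) / norm c"
        using norm_pairing_le_sup_seminorm[of y "scaleX c x"] False
        by (simp add: pairing_scale_left norm_mult field_simps)
    qed
    then show ?thesis using False by (simp add: field_simps)
  qed (simp add: sup_seminorm_nonneg)
qed

lemma sup_seminorm_scaleR: "sup_seminorm pairing K (r *\<^sub>R x) = \<bar>r\<bar> * sup_seminorm pairing K x"
  using sup_seminorm_scale[of "of_real r" x] by (simp add: X.scale_of_real)

lemma sup_seminorm_zero [simp]: "sup_seminorm pairing K 0 = 0"
  using sup_seminorm_scaleR[of 0 0] by simp

lemma sup_seminorm_diff_commute: "sup_seminorm pairing K (x - x') = sup_seminorm pairing K (x' - x)"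
  using sup_seminorm_scaleR[of "-1" "x - x'"] by simp

lemma sup_seminorm_abs_diff_le:
  "\<bar>sup_seminorm pairing K x - sup_seminorm pairing K x'\<bar> \<le> sup_seminorm pairing K (x - x')"
  using sup_seminorm_add[of "x - x'" x'] sup_seminorm_add[of "x' - x" x]
    sup_seminorm_diff_commute[of x x'] by simp

text \<open>Weak compactness bounds the functionals in \<open>K\<close> at each \<open>x\<close>;
  uniform boundedness then gives one constant. This norm bound on \<open>K\<close> is what converts
  the growth bound of the semigroup into decay of \<open>p\<^sub>K\<close>.\<close>

lemma sup_seminorm_le_norm:
  obtains C where "0 \<le> C" "\<And>x. sup_seminorm pairing K x \<le> C * norm x"
proof -
  obtain C where "0 \<le> C" "\<And>y x. y \<in> K \<Longrightarrow> norm (pairing x y) \<le> C * norm x"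
    by (rule uniform_boundedness[of K "\<lambda>y x. pairing x y"])
      (use bounded_linear_pairing norm_pairing_le_sup_seminorm in blast)+
  then show thesis by (intro that) (auto intro: sup_seminorm_le)
qed

end

end

section \<open>Continuous seminorms and operators for tau_+\<close>

context ordered_norming_dual_pair
begin

lemma cone_compact_zero: "cone_compact pairing {0}"
  by (simp add: cone_compact_def dual_cone_def)

lemma cone_compact_Un:
  "cone_compact pairing K \<Longrightarrow> cone_compact pairing L \<Longrightarrow> cone_compact pairing (K \<union> L)"
  by (auto simp: cone_compact_def compactin_Un)

lemma cone_compact_imp:
  assumes "cone_compact pairing K"
  shows "compactin (sigma_Y pairing) K" "K \<noteq> {}"
  using assms by (auto simp: cone_compact_def)

lemma continuous_map_sup_seminorm:
  assumes K: "cone_compact pairing K"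
  shows "continuous_map (tau_plus pairing) euclideanreal (\<lambda>x. sup_seminorm pairing K (x - a))"
proof -
  note K' = cone_compact_imp[OF K]
  have "\<exists>U. openin (tau_plus pairing) U \<and> x \<in> U \<and>
      (\<forall>y\<in>U. dist (sup_seminorm pairing K (x - a)) (sup_seminorm pairing K (y - a)) < e)"
    if "0 < e" for x e
  proof (intro exI conjI ballI)
    show "openin (tau_plus pairing) {y. sup_seminorm pairing K (y - x) < e}"
      unfolding tau_plus_eq by (rule openin_seminorm_ball) (use K that in auto)
    show "x \<in> {y. sup_seminorm pairing K (y - x) < e}" using that K' by simp
    fix y assume "y \<in> {y. sup_seminorm pairing K (y - x) < e}"
    then show "dist (sup_seminorm pairing K (x - a)) (sup_seminorm pairing K (y - a)) < e"
      using sup_seminorm_abs_diff_le[OF K', of "x - a" "y - a"] sup_seminorm_diff_commute[OF K', of x y]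
      by (simp add: dist_real_def)
  qed
  then show ?thesis
    using Met_TC.continuous_map_to_metric[of "tau_plus pairing" "\<lambda>x. sup_seminorm pairing K (x - a)"]
    by simp
qed

text \<open>The factor \<open>C\<close> is carried along because a general continuous seminorm is
  bounded only by a multiple of some \<open>p\<^sub>K\<close>.\<close>

lemma continuous_seminorm_sup_seminorm:
  assumes K: "cone_compact pairing K" and "0 \<le> C"
  shows "(\<lambda>x. C * sup_seminorm pairing K x) \<in> continuous_seminorms scaleX (tau_plus pairing)"
proof -
  note K' = cone_compact_imp[OF K]
  have "C * sup_seminorm pairing K (x + y) \<le> C * sup_seminorm pairing K x + C * sup_seminorm pairing K y" for x y
    using mult_left_mono[OF sup_seminorm_add[OF K'] \<open>0 \<le> C\<close>] by (simp add: distrib_left)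
  then show ?thesis
    using continuous_map_sup_seminorm[OF K, of 0] \<open>0 \<le> C\<close>
    by (auto simp: continuous_seminorms_def seminorm_def sup_seminorm_nonneg[OF K']
        sup_seminorm_scale[OF K'] intro: continuous_map_real_mult_left)
qed

text \<open>The generating seminorms are directed: finite unions of admissible sets are admissible,
  and \<open>{0}\<close> serves the empty family.\<close>

lemma finite_family_dominated:
  assumes "finite F" "F \<subseteq> sup_seminorm pairing ` {K. cone_compact pairing K}"
  shows "\<exists>K. cone_compact pairing K \<and> (\<forall>p\<in>F. \<forall>x. p x \<le> sup_seminorm pairing K x)"
  using assms
proof (induction F rule: finite_induct)
  case empty
  then show ?case using cone_compact_zero by auto
next
  case (insert p F)
  then obtain K where K: "cone_compact pairing K" "\<forall>p\<in>F. \<forall>x. p x \<le> sup_seminorm pairing K x"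
    by auto
  obtain L where L: "cone_compact pairing L" "p = sup_seminorm pairing L"
    using insert.prems by auto
  note KL = cone_compact_imp[OF cone_compact_Un[OF K(1) L(1)]]
  have "sup_seminorm pairing K x \<le> sup_seminorm pairing (K \<union> L) x"
    "sup_seminorm pairing L x \<le> sup_seminorm pairing (K \<union> L) x" for x
    by (auto intro!: sup_seminorm_le cone_compact_imp K L norm_pairing_le_sup_seminorm[OF KL])
  then have "\<forall>q\<in>insert p F. \<forall>x. q x \<le> sup_seminorm pairing (K \<union> L) x"
    using K(2) L(2) order_trans by blast
  then show ?case using cone_compact_Un[OF K(1) L(1)] by blast
qed

text \<open>Continuity at 0 together with directedness puts a ball \<open>p\<^sub>K < e\<close>
  inside \<open>p < 1\<close>; homogeneity then yields the constant \<open>1 / e\<close>.\<close>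

lemma continuous_seminorm_dominated:
  assumes p: "p \<in> continuous_seminorms scaleX (tau_plus pairing)"
  obtains K C where "cone_compact pairing K" "0 \<le> C" "\<And>x. p x \<le> C * sup_seminorm pairing K x"
proof -
  have p_scale: "p (r *\<^sub>R x) = \<bar>r\<bar> * p x" for r x
  proof -
    have "p (scaleX (of_real r) x) = norm (of_real r :: 'k) * p x"
      using p unfolding continuous_seminorms_def seminorm_def by blast
    then show ?thesis by (simp add: X.scale_of_real)
  qed
  have "openin (tau_plus pairing) {x \<in> topspace (tau_plus pairing). p x \<in> {..<1}}"
    by (rule openin_continuous_map_preimage[of _ euclideanreal])
      (use p in \<open>auto simp: continuous_seminorms_def\<close>)
  then have "openin (seminorm_topology (sup_seminorm pairing ` {K. cone_compact pairing K})) {x. p x < 1}"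
    by (simp add: tau_plus_eq)
  moreover have "q (x + y) \<le> q x + q y"
    if q: "q \<in> sup_seminorm pairing ` {K. cone_compact pairing K}" for q x y
  proof -
    obtain K where "cone_compact pairing K" "q = sup_seminorm pairing K" using q by auto
    then show ?thesis using sup_seminorm_add[OF cone_compact_imp] by simp
  qed
  moreover have "0 \<in> {x. p x < 1}" using p_scale[of 0 0] by simp
  ultimately obtain F e where F: "finite F" "F \<subseteq> sup_seminorm pairing ` {K. cone_compact pairing K}" "0 < e"
    "{x. \<forall>p\<in>F. p x < e} \<subseteq> {x. p x < 1}"
    using seminorm_topology_contains_basic
      [of "sup_seminorm pairing ` {K. cone_compact pairing K}" "{x. p x < 1}" 0] by auto
  obtain K where K: "cone_compact pairing K" "\<forall>p\<in>F. \<forall>x. p x \<le> sup_seminorm pairing K x"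
    using finite_family_dominated[OF F(1,2)] by blast
  note K' = cone_compact_imp[OF K(1)]
  have small: "p x < 1" if "sup_seminorm pairing K x < e" for x
    using F(4) K(2) that order_le_less_trans by blast
  have "p x \<le> 1 / e * sup_seminorm pairing K x" for x
  proof (rule field_le_epsilon)
    fix d :: real assume d: "0 < d"
    \<comment> \<open>The summand \<open>d\<close> keeps \<open>u\<close> positive when
      \<open>p\<^sub>K\<close> vanishes at \<open>x\<close>, and makes \<open>x / u\<close> lie
      strictly inside the ball of radius \<open>e\<close>.\<close>
    define u where "u = sup_seminorm pairing K x / e + d"
    have u: "0 < u" "sup_seminorm pairing K x < e * u"
      using d F(3) sup_seminorm_nonneg[OF K', of x]
      by (auto simp: u_def distrib_left intro: add_nonneg_pos)
    have "p ((1 / u) *\<^sub>R x) < 1"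
      by (rule small) (use u in \<open>simp add: sup_seminorm_scaleR[OF K'] field_simps\<close>)
    then show "p x \<le> 1 / e * sup_seminorm pairing K x + d"
      using u by (simp add: p_scale u_def field_simps)
  qed
  then show thesis using that K(1) F(3) by (metis divide_nonneg_pos zero_le_one)
qed

text \<open>By linearity, domination of \<open>p\<^sub>K\<close> after \<open>S\<close> by a single
  \<open>p\<^sub>L\<close> carries an estimate at 0 to every point \<open>x\<close>: a
  \<open>p\<^sub>L\<close>-ball around \<open>x\<close> fits into the preimage of a
  \<open>p\<^sub>K\<close>-ball.\<close>

lemma continuous_operator_tau_plus:
  assumes lin: "Vector_Spaces.linear scaleX scaleX S"
    and dom: "\<And>K. cone_compact pairing K \<Longrightarrow> \<exists>L. cone_compact pairing L \<and>
      (\<forall>x. sup_seminorm pairing K (S x) \<le> sup_seminorm pairing L x)"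
  shows "S \<in> continuous_operators scaleX (tau_plus pairing)"
proof -
  interpret S: Vector_Spaces.linear scaleX scaleX S by (rule lin)
  have "openin (tau_plus pairing) (S -` {x. sup_seminorm pairing K (x - a) < e})"
    if K: "cone_compact pairing K" for K a e
  proof (subst openin_subopen, intro ballI)
    fix x assume x: "x \<in> S -` {x. sup_seminorm pairing K (x - a) < e}"
    obtain L where L: "cone_compact pairing L" "\<And>x. sup_seminorm pairing K (S x) \<le> sup_seminorm pairing L x"
      using dom[OF K] by blast
    let ?U = "{z. sup_seminorm pairing L (z - x) < e - sup_seminorm pairing K (S x - a)}"
    have "openin (tau_plus pairing) ?U"
      unfolding tau_plus_eq by (rule openin_seminorm_ball) (use L x in auto)
    moreover have "x \<in> ?U" using x L cone_compact_imp[OF L(1)] by simp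
    moreover have "z \<in> S -` {x. sup_seminorm pairing K (x - a) < e}" if "z \<in> ?U" for z
      using that L(2)[of "z - x"] sup_seminorm_add[OF cone_compact_imp[OF K], of "S z - S x" "S x - a"]
      by (simp add: S.diff)
    ultimately show "\<exists>U. openin (tau_plus pairing) U \<and> x \<in> U \<and>
        U \<subseteq> S -` {x. sup_seminorm pairing K (x - a) < e}" by blast
  qed
  moreover have "openin (tau_plus pairing) UNIV"
    using openin_topspace[of "tau_plus pairing"] by simp
  ultimately have "continuous_map (tau_plus pairing) (tau_plus pairing) S"
    unfolding tau_plus_eq[of pairing] seminorm_topology_def
    by (intro continuous_on_generated_topo) (auto simp flip: seminorm_topology_def tau_plus_eq simp del: topology_generated_by_topspace)
  then show ?thesis using lin by (simp add: continuous_operators_def)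
qed

section \<open>Compactness of adjoint orbits\<close>

text \<open>The set \<open>L\<close> consists of the functionals \<open>A(s)'y\<close> with \<open>s \<in> I\<close> and \<open>y \<in> K\<close>, where \<open>A(s)'\<close> is the
  adjoint of \<open>A(s)\<close>; it is compact because \<open>(s, y) \<mapsto> A(s)'y\<close> is jointly continuous on \<open>I \<times> K\<close>.\<close>

lemma compact_adjoint_orbit:
  fixes I :: "'a::metric_space set"
  assumes I: "compact I" "I \<noteq> {}" and K: "cone_compact pairing K"
    and adjoint: "\<And>s y. s \<in> I \<Longrightarrow> \<exists>y'. \<forall>x. pairing (A s x) y = pairing x y'"
    and pos: "\<And>s x. s \<in> I \<Longrightarrow> 0 \<le> x \<Longrightarrow> 0 \<le> A s x"
    and cont: "\<And>s0 x. s0 \<in> I \<Longrightarrow>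
      ((\<lambda>s. sup_seminorm pairing K (A s x - A s0 x)) \<longlongrightarrow> 0) (at s0 within I)"
  obtains L where "cone_compact pairing L"
    "\<And>s x. s \<in> I \<Longrightarrow> sup_seminorm pairing K (A s x) \<le> sup_seminorm pairing L x"
proof -
  note K' = cone_compact_imp[OF K]
  \<comment> \<open>A choice of adjoints: \<open>B s y\<close> is the vector
    \<open>A(s)'y\<close>.\<close>
  obtain B where B: "\<And>s y x. s \<in> I \<Longrightarrow> pairing (A s x) y = pairing x (B s y)"
    using adjoint by metis
  define Z where "Z = prod_topology (top_of_set I) (subtopology (sigma_Y pairing) K)"
  have topspace_Z: "topspace Z = I \<times> K" by (simp add: Z_def)
  define L where "L = case_prod B ` (I \<times> K)"
  \<comment> \<open>Two halves of \<open>e\<close>: replacing \<open>s\<close> by \<open>s0\<close>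
    costs at most \<open>p\<^sub>K\<close> of the difference, uniformly in \<open>y\<close> from
    \<open>K\<close>; with \<open>s0\<close> fixed, weak continuity in \<open>y\<close> gives the
    rest.\<close>
  have joint: "continuous_map Z euclidean (\<lambda>(s, y). pairing (A s x) y)" for x
  proof -
    let ?f = "\<lambda>(s, y). pairing (A s x) y"
    have "\<exists>U. openin Z U \<and> q0 \<in> U \<and> (\<forall>q\<in>U. ?f q \<in> Met_TC.mball (?f q0) e)"
      if q0: "q0 \<in> topspace Z" and e: "0 < e" for q0 e
    proof -
      obtain s0 y0 where q0_eq: "q0 = (s0, y0)" by fastforce
      have s0: "s0 \<in> I" and y0: "y0 \<in> K" using q0 by (auto simp: q0_eq topspace_Z)
      let ?p = "sup_seminorm pairing K"
      have "\<forall>\<^sub>F s in at s0 within I. ?p (A s x - A s0 x) < e / 2"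
        by (rule order_tendstoD(2)[OF cont[OF s0]]) (use e in simp)
      then obtain d where d: "0 < d"
        "\<forall>s\<in>I. s \<noteq> s0 \<and> dist s s0 < d \<longrightarrow> ?p (A s x - A s0 x) < e / 2"
        unfolding eventually_at by (elim exE conjE)
      \<comment> \<open>The limit filter leaves out \<open>s0\<close>, where the difference is
        0.\<close>
      have d': "?p (A s x - A s0 x) < e / 2" if "s \<in> I" "dist s s0 < d" for s
      proof (cases "s = s0")
        case True
        then show ?thesis using e by (simp add: sup_seminorm_zero[OF K'])
      next
        case False
        then show ?thesis using d(2) that by simp
      qed
      let ?V = "{y. dist (pairing (A s0 x) y0) (pairing (A s0 x) y) < e / 2}"
      have "openin (sigma_Y pairing) {y \<in> topspace (sigma_Y pairing).
          pairing (A s0 x) y \<in> ball (pairing (A s0 x) y0) (e / 2)}"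
        by (rule openin_continuous_map_preimage[OF continuous_map_pairing]) simp
      then have V: "openin (sigma_Y pairing) ?V" by simp
      let ?U = "(I \<inter> ball s0 d) \<times> (K \<inter> ?V)"
      show ?thesis
      proof (intro exI[of _ ?U] conjI ballI)
        show "openin Z ?U"
          unfolding Z_def openin_prod_Times_iff using V
          by (simp add: openin_subtopology_Int2 openin_open_Int)
        show "q0 \<in> ?U" using s0 y0 d(1) e by (simp add: q0_eq)
        fix q assume "q \<in> ?U"
        then obtain s y where q: "q = (s, y)" "s \<in> I" "dist s s0 < d" "y \<in> K" "y \<in> ?V"
          by (auto simp: dist_commute)
        have "dist (pairing (A s0 x) y) (pairing (A s x) y) = norm (pairing (A s x - A s0 x) y)"
          by (simp add: dist_norm norm_minus_commute pairing_diff_left)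
        also have "\<dots> \<le> ?p (A s x - A s0 x)"
          using q(4) by (rule norm_pairing_le_sup_seminorm[OF K'])
        also have "\<dots> < e / 2" using q(2,3) by (rule d')
        finally have "dist (pairing (A s0 x) y) (pairing (A s x) y) < e / 2" .
        moreover have "dist (pairing (A s0 x) y0) (pairing (A s0 x) y) < e / 2" using q(5) by simp
        ultimately have "dist (pairing (A s0 x) y0) (pairing (A s x) y) < e"
          using dist_triangle[of "pairing (A s0 x) y0" "pairing (A s x) y" "pairing (A s0 x) y"] by linarith
        then show "?f q \<in> Met_TC.mball (?f q0) e" by (simp add: q(1) q0_eq)
      qed
    qed
    then have "continuous_map Z Met_TC.mtopology ?f"
      unfolding Met_TC.continuous_map_to_metric by blast
    then show ?thesis by simp
  qed
  \<comment> \<open>Continuity into the weak topology is tested on each \<open>x\<close> separately,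
    which is exactly \<open>joint\<close>.\<close>
  have "continuous_map Z (sigma_Y pairing) (case_prod B)"
    unfolding weak_topology_def
  proof (rule continuous_on_generated_topo)
    fix W assume "W \<in> {(\<lambda>y. pairing x y) -` U | x U. open U}"
    then obtain x U where W: "W = (\<lambda>y. pairing x y) -` U" "open U" by auto
    have "openin Z {q \<in> topspace Z. (\<lambda>(s, y). pairing (A s x) y) q \<in> U}"
      by (rule openin_continuous_map_preimage[OF joint]) (use W in simp)
    also have "{q \<in> topspace Z. (\<lambda>(s, y). pairing (A s x) y) q \<in> U} = case_prod B -` W \<inter> topspace Z"
      by (auto simp: topspace_Z W B)
    finally show "openin Z (case_prod B -` W \<inter> topspace Z)" .
  next
    show "case_prod B ` topspace Z \<subseteq> \<Union> {(\<lambda>y. pairing x y) -` U | x U. open U}"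
      using open_UNIV by blast
  qed
  moreover have "compactin Z (I \<times> K)"
    using I K' by (simp add: Z_def compactin_Times compactin_subtopology)
  ultimately have "compactin (sigma_Y pairing) L"
    unfolding L_def by (intro image_compactin)
  moreover have "L \<subseteq> dual_cone pairing"
  proof
    fix z assume "z \<in> L"
    then obtain s y where z: "z = B s y" "s \<in> I" "y \<in> K" by (auto simp: L_def)
    have "pairing x z \<in> \<real>\<^sub>\<ge>\<^sub>0" if "0 \<le> x" for x
    proof -
      have "y \<in> dual_cone pairing" using K z(3) by (auto simp: cone_compact_def)
      then have "pairing (A s x) y \<in> \<real>\<^sub>\<ge>\<^sub>0" using pos[OF z(2) that] by (simp add: dual_cone_def)
      then show ?thesis by (simp only: B[OF z(2)] z(1))
    qed
    then show "z \<in> dual_cone pairing" by (simp add: dual_cone_def)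
  qed
  ultimately have L: "cone_compact pairing L"
    using I K' by (simp add: cone_compact_def L_def)
  show thesis
  proof (rule that[OF L])
    fix s x assume s: "s \<in> I"
    show "sup_seminorm pairing K (A s x) \<le> sup_seminorm pairing L x"
    proof (rule sup_seminorm_le[OF K'])
      fix y assume "y \<in> K"
      then show "norm (pairing (A s x) y) \<le> sup_seminorm pairing L x"
        unfolding B[OF s] using s
        by (intro norm_pairing_le_sup_seminorm cone_compact_imp[OF L]) (auto simp: L_def)
    qed
  qed
qed

section \<open>Domination of rescaled orbits and quasi-equicontinuity\<close>

text \<open>Reduces the claim to the seminorms \<open>p\<^sub>K\<close>: the same domination gives
  continuity of each rescaled operator and, with \<open>L\<close> independent of \<open>t\<close>,
  equicontinuity of the family.\<close>

lemma quasi_equicontinuous_if_dominated: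
  assumes lin: "\<And>t. 0 \<le> t \<Longrightarrow> Vector_Spaces.linear scaleX scaleX (T t)"
    and dom: "\<And>K. cone_compact pairing K \<Longrightarrow> \<exists>L. cone_compact pairing L \<and> (\<forall>t\<ge>0. \<forall>x.
      sup_seminorm pairing K (exp (- \<alpha> * t) *\<^sub>R T t x) \<le> sup_seminorm pairing L x)"
  shows "quasi_equicontinuous scaleX (tau_plus pairing) \<alpha> T"
  unfolding quasi_equicontinuous_def equicontinuous_def X.scale_of_real
proof (intro conjI ballI)
  show "{\<lambda>x. exp (- \<alpha> * t) *\<^sub>R T t x |t. 0 \<le> t} \<subseteq> continuous_operators scaleX (tau_plus pairing)"
  proof clarify
    fix t :: real assume t: "0 \<le> t"
    show "(\<lambda>x. exp (- \<alpha> * t) *\<^sub>R T t x) \<in> continuous_operators scaleX (tau_plus pairing)"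
    proof (rule continuous_operator_tau_plus)
      have "Vector_Spaces.linear scaleX scaleX (\<lambda>x. scaleX (of_real (exp (- \<alpha> * t))) (T t x))"
        using lin[OF t] unfolding Vector_Spaces.linear_iff
        by (simp add: X.scale_right_distrib mult.commute)
      then show "Vector_Spaces.linear scaleX scaleX (\<lambda>x. exp (- \<alpha> * t) *\<^sub>R T t x)"
        unfolding X.scale_of_real .
    qed (use dom t in blast)
  qed
next
  fix p assume "p \<in> continuous_seminorms scaleX (tau_plus pairing)"
  then obtain K C where K: "cone_compact pairing K" "0 \<le> C" "\<And>x. p x \<le> C * sup_seminorm pairing K x"
    using continuous_seminorm_dominated by blast
  obtain L where L: "cone_compact pairing L" "\<And>t x. 0 \<le> t \<Longrightarrow>
      sup_seminorm pairing K (exp (- \<alpha> * t) *\<^sub>R T t x) \<le> sup_seminorm pairing L x"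
    using dom[OF K(1)] by blast
  show "\<exists>q\<in>continuous_seminorms scaleX (tau_plus pairing).
      \<forall>S\<in>{\<lambda>x. exp (- \<alpha> * t) *\<^sub>R T t x |t. 0 \<le> t}. \<forall>x. p (S x) \<le> q x"
  proof (intro bexI ballI allI)
    fix S x assume "S \<in> {\<lambda>x. exp (- \<alpha> * t) *\<^sub>R T t x |t. 0 \<le> t}"
    then show "p (S x) \<le> C * sup_seminorm pairing L x"
      using order_trans[OF K(3) mult_left_mono[OF L(2) K(2)]] by auto
  qed (rule continuous_seminorm_sup_seminorm[OF L(1) K(2)])
qed

text \<open>As \<open>p\<^sub>K\<close> is bounded by \<open>C\<close> times the norm, the type of
  \<open>T\<close> gives the bound \<open>C * M * norm x * exp ((\<omega> - \<alpha>) * t)\<close>,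
  whose exponent is negative for positive \<open>t\<close>.\<close>

lemma rescaled_orbit_tendsto_zero:
  assumes T: "semigroup_of_type scaleX pairing M \<omega> T" and \<alpha>: "\<omega> < \<alpha>"
    and K: "cone_compact pairing K"
  shows "((\<lambda>t. sup_seminorm pairing K (exp (- \<alpha> * t) *\<^sub>R T t x)) \<longlongrightarrow> 0) at_top"
proof -
  note K' = cone_compact_imp[OF K]
  obtain C where C: "0 \<le> C" "\<And>x. sup_seminorm pairing K x \<le> C * norm x"
    by (rule sup_seminorm_le_norm[OF K'], rule that)
  have le: "sup_seminorm pairing K (exp (- \<alpha> * t) *\<^sub>R T t x) \<le> C * M * norm x * exp ((\<omega> - \<alpha>) * t)"
    if t: "0 \<le> t" for t
  proof -
    have "norm (T t x) \<le> onorm (T t) * norm x"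
      using T t by (intro onorm) (auto simp: semigroup_of_type_def)
    also have "\<dots> \<le> M * exp (\<omega> * t) * norm x"
      using T t by (intro mult_right_mono) (auto simp: semigroup_of_type_def)
    finally have "C * (exp (- \<alpha> * t) * norm (T t x)) \<le> C * (exp (- \<alpha> * t) * (M * exp (\<omega> * t) * norm x))"
      using C(1) by (intro mult_left_mono) auto
    also have "\<dots> = C * M * norm x * exp ((\<omega> - \<alpha>) * t)"
      by (simp add: algebra_simps exp_diff exp_minus field_simps)
    finally show ?thesis using C(2)[of "exp (- \<alpha> * t) *\<^sub>R T t x"] by simp
  qed
  have "((\<lambda>t. exp ((\<omega> - \<alpha>) * t)) \<longlongrightarrow> 0) at_top"
    using \<alpha> by (intro filterlim_compose[OF exp_at_bot]
        filterlim_tendsto_neg_mult_at_bot[OF tendsto_const _ filterlim_ident]) simp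
  then have lim: "((\<lambda>t. C * M * norm x * exp ((\<omega> - \<alpha>) * t)) \<longlongrightarrow> 0) at_top"
    by (rule tendsto_mult_right_zero)
  show ?thesis
  proof (rule tendsto_sandwich[OF _ _ tendsto_const lim])
    show "\<forall>\<^sub>F t in at_top. 0 \<le> sup_seminorm pairing K (exp (- \<alpha> * t) *\<^sub>R T t x)"
      by (simp add: sup_seminorm_nonneg[OF K'])
    show "\<forall>\<^sub>F t in at_top. sup_seminorm pairing K (exp (- \<alpha> * t) *\<^sub>R T t x)
        \<le> C * M * norm x * exp ((\<omega> - \<alpha>) * t)"
      using eventually_ge_at_top[of 0] by eventually_elim (rule le)
  qed
qed

text \<open>Applies \<open>compact_adjoint_orbit\<close> to the compact parameter interval
  \<open>{0..1}\<close>, in which 1 stands for time 0 and 0 for time infinity.\<close>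

lemma orbit_dominated:
  assumes T: "semigroup_of_type scaleX pairing M \<omega> T" and pos: "positive_semigroup T"
    and cont: "continuous_semigroup (tau_plus pairing) T" and \<alpha>: "\<omega> < \<alpha>"
    and K: "cone_compact pairing K"
  shows "\<exists>L. cone_compact pairing L \<and> (\<forall>t\<ge>0. \<forall>x.
      sup_seminorm pairing K (exp (- \<alpha> * t) *\<^sub>R T t x) \<le> sup_seminorm pairing L x)"
proof -
  note K' = cone_compact_imp[OF K]
  let ?p = "sup_seminorm pairing K"
  define S where "S t x = exp (- \<alpha> * t) *\<^sub>R T t x" for t x
  \<comment> \<open>\<open>s \<mapsto> 1/s - 1\<close> identifies \<open>[0,1]\<close> with the compactified half-line \<open>[0,\<infinity>]\<close>.\<close>
  define \<tau> where "\<tau> s = inverse s - 1" for s :: real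
  \<comment> \<open>The value 0 at \<open>s = 0\<close> is the limit of the rescaled orbit at
    infinity.\<close>
  define A where "A s x = (if s = 0 then 0 else S (\<tau> s) x)" for s x
  have \<tau>_nonneg: "0 \<le> \<tau> s" if "s \<in> {0..1}" "s \<noteq> 0" for s
    using that by (simp add: \<tau>_def field_simps)
  \<comment> \<open>The shift \<open>a\<close> will be the value of the orbit at the limit
    point.\<close>
  have cont_T: "continuous_on {0..} (\<lambda>t. ?p (T t x - a))" for x a
    using continuous_map_compose[OF _ continuous_map_sup_seminorm[OF K, of a], of "top_of_set {0..}" "\<lambda>t. T t x"] cont
    by (simp add: continuous_semigroup_def o_def)
  have zero: "((\<lambda>s. ?p (A s x - A 0 x)) \<longlongrightarrow> 0) (at 0 within {0..1})" for x
  proof -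
    have "filterlim (\<lambda>s::real. - 1 + inverse s) at_top (at_right 0)"
      by (rule filterlim_tendsto_add_at_top[OF tendsto_const filterlim_inverse_at_top_right])
    then have "filterlim \<tau> at_top (at_right 0)" by (simp add: \<tau>_def[abs_def])
    from filterlim_compose[OF rescaled_orbit_tendsto_zero[OF T \<alpha> K] this]
    have "((\<lambda>s. ?p (S (\<tau> s) x)) \<longlongrightarrow> 0) (at_right 0)" by (simp add: S_def)
    moreover have "\<forall>\<^sub>F s in at_right 0. ?p (S (\<tau> s) x) = ?p (A s x - A 0 x)"
      by (auto simp: A_def eventually_at_filter)
    ultimately have "((\<lambda>s. ?p (A s x - A 0 x)) \<longlongrightarrow> 0) (at_right 0)"
      by (rule Lim_transform_eventually)
    then show ?thesis by (simp add: at_within_Icc_at_right)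
  qed
  have positive: "((\<lambda>s. ?p (A s x - A s0 x)) \<longlongrightarrow> 0) (at s0 within {0..1})"
    if s0: "s0 \<in> {0<..1}" for s0 x
  proof -
    \<comment> \<open>Product-rule bound from inserting the mixed term
      \<open>exp (- \<alpha> * \<tau> s) *\<^sub>R T (\<tau> s0) x\<close>; it is continuous on
      \<open>{0<..1}\<close> and vanishes at \<open>s0\<close>.\<close>
    define b where "b s = exp (- \<alpha> * \<tau> s) * ?p (T (\<tau> s) x - T (\<tau> s0) x)
      + \<bar>exp (- \<alpha> * \<tau> s) - exp (- \<alpha> * \<tau> s0)\<bar> * ?p (T (\<tau> s0) x)" for s
    have \<tau>: "continuous_on {0<..1} \<tau>" unfolding \<tau>_def by (intro continuous_intros) auto
    have "continuous_on {0<..1} (\<lambda>s. ?p (T (\<tau> s) x - T (\<tau> s0) x))"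
      by (rule continuous_on_compose2[OF cont_T \<tau>]) (use \<tau>_nonneg in auto)
    then have "continuous_on {0<..1} b" unfolding b_def by (intro continuous_intros \<tau>)
    then have "(b \<longlongrightarrow> b s0) (at s0 within {0<..1})"
      using s0 unfolding continuous_on_def by blast
    \<comment> \<open>Near \<open>s0 > 0\<close> the endpoint 0, where \<open>\<tau>\<close> is not
      the intended time, is invisible.\<close>
    moreover have at_eq: "at s0 within {0..1} = at s0 within {0<..1}"
      by (rule at_within_nhd[of _ "{0<..}"]) (use s0 in auto)
    ultimately have lim: "(b \<longlongrightarrow> 0) (at s0 within {0..1})" by (simp add: b_def K')
    have le: "?p (A s x - A s0 x) \<le> b s" if "s \<in> {0<..1}" for s
    proof -
      have "A s x - A s0 x = exp (- \<alpha> * \<tau> s) *\<^sub>R (T (\<tau> s) x - T (\<tau> s0) x)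
          + (exp (- \<alpha> * \<tau> s) - exp (- \<alpha> * \<tau> s0)) *\<^sub>R T (\<tau> s0) x"
        using s0 that by (simp add: A_def S_def scaleR_diff_left scaleR_diff_right)
      also have "?p \<dots> \<le> ?p (exp (- \<alpha> * \<tau> s) *\<^sub>R (T (\<tau> s) x - T (\<tau> s0) x))
          + ?p ((exp (- \<alpha> * \<tau> s) - exp (- \<alpha> * \<tau> s0)) *\<^sub>R T (\<tau> s0) x)"
        by (rule sup_seminorm_add[OF K'])
      finally show ?thesis by (simp only: b_def sup_seminorm_scaleR[OF K'] abs_exp_cancel)
    qed
    have "\<forall>\<^sub>F s in at s0 within {0<..1}. ?p (A s x - A s0 x) \<le> b s"
      unfolding eventually_at_filter by (intro always_eventually allI impI le)
    then have "\<forall>\<^sub>F s in at s0 within {0..1}. ?p (A s x - A s0 x) \<le> b s"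
      by (simp only: at_eq)
    then show ?thesis
      by (intro tendsto_sandwich[OF _ _ tendsto_const lim]) (simp add: sup_seminorm_nonneg[OF K'])
  qed
  obtain L where L: "cone_compact pairing L" "\<And>s x. s \<in> {0..1} \<Longrightarrow> ?p (A s x) \<le> sup_seminorm pairing L x"
  proof (rule compact_adjoint_orbit[of "{0..1::real}" K A])
    show "compact {0..1::real}" "{0..1::real} \<noteq> {}" by simp_all
    show "cone_compact pairing K" by (rule K)
  next
    fix s y assume s: "s \<in> {0..1::real}"
    show "\<exists>y'. \<forall>x. pairing (A s x) y = pairing x y'"
    proof (cases "s = 0")
      case True
      then show ?thesis by (intro exI[of _ 0]) (simp add: A_def)
    next
      case False
      have "T (\<tau> s) \<in> continuous_operators scaleX (sigma_X pairing)"
        using T \<tau>_nonneg[OF s False] by (simp add: semigroup_of_type_def)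
      from adjoint_exists[OF this, of y]
      obtain y' where "\<forall>x. pairing (T (\<tau> s) x) y = pairing x y'" by (elim exE)
      then show ?thesis using False
        by (intro exI[of _ "exp (- \<alpha> * \<tau> s) *\<^sub>R y'"])
          (simp add: A_def S_def pairing_scaleR_left pairing_scaleR_right)
    qed
  next
    fix s x assume s: "s \<in> {0..1::real}" "0 \<le> (x::'x)"
    have "0 \<le> T (\<tau> s) x" if "s \<noteq> 0"
      using pos \<tau>_nonneg[OF s(1) that] s(2)
      by (auto simp: positive_semigroup_def positive_operator_def)
    then show "0 \<le> A s x" by (simp add: A_def S_def scaleR_nonneg_nonneg)
  next
    fix s0 x assume "s0 \<in> {0..1::real}"
    then show "((\<lambda>s. ?p (A s x - A s0 x)) \<longlongrightarrow> 0) (at s0 within {0..1})"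
      using zero positive[of s0] by (cases "s0 = 0") auto
  qed (rule that)
  have "?p (S t x) \<le> sup_seminorm pairing L x" if t: "0 \<le> t" for t x
    \<comment> \<open>\<open>inverse (1 + t)\<close> is the parameter in \<open>{0<..1}\<close> that
      \<open>\<tau>\<close> sends to \<open>t\<close>.\<close>
    using L(2)[of "inverse (1 + t)" x] t by (simp add: A_def \<tau>_def field_simps)
  then show ?thesis using L(1) unfolding S_def by (intro exI[of _ L]) simp
qed

end

theorem theorem3p11:
  fixes scaleX :: "'k::real_normed_field \<Rightarrow> 'x::{banach, ordered_real_vector} \<Rightarrow> 'x"
    and scaleY :: "'k \<Rightarrow> 'y::banach \<Rightarrow> 'y"
    and pairing :: "'x \<Rightarrow> 'y \<Rightarrow> 'k"
    and T :: "real \<Rightarrow> 'x \<Rightarrow> 'x"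
    and M \<omega> :: real
  assumes "ordered_norming_dual_pair scaleX scaleY pairing"
    and "semigroup_of_type scaleX pairing M \<omega> T"
    and "positive_semigroup T"
    and "continuous_semigroup (tau_plus pairing) T"
  shows "\<forall>\<alpha>>\<omega>. quasi_equicontinuous scaleX (tau_plus pairing) \<alpha> T"
proof (intro allI impI)
  fix \<alpha> assume \<alpha>: "\<omega> < \<alpha>"
  interpret ordered_norming_dual_pair scaleX scaleY pairing by fact
  show "quasi_equicontinuous scaleX (tau_plus pairing) \<alpha> T"
  proof (rule quasi_equicontinuous_if_dominated)
    show "Vector_Spaces.linear scaleX scaleX (T t)" if "0 \<le> t" for t
      using assms(2) that by (auto simp: semigroup_of_type_def continuous_operators_def)
  qed (rule orbit_dominated[OF assms(2-4) \<alpha>])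
qed

end
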